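(* Let $f:\mathbb{Z}^n\to\mathbb{R}\cup\{+\infty\}$ be a locally or globally discrete midpoint convex function, $\alpha$ a positive integer, and $x^\alpha\in\operatorname{dom} f$. If $f(x^\alpha)\le f(x^\alpha+\alpha d)$ for all $d\in\{-1,0,+1\}^n$, then there exists a minimizer $x^*\in\mathbb{Z}^n$ of $f$ with $\|x^\alpha-x^*\|_\infty\le n(\alpha-1)$.
   Context: For $x\in\mathbb{R}^n$, $\lceil x\rceil$ and $\lfloor x\rfloor$ denote the integer vectors obtained by rounding each component up, respectively down. The effective domain of $f:\mathbb{Z}^n\to\mathbb{R}\cup\{+\infty\}$ is $\operatorname{dom} f=\{x\in\mathbb{Z}^n\mid f(x)<+\infty\}$. A set $S\subseteq\mathbb{Z}^n$ is discrete midpoint convex if for all $x,y\in S$ with $\|x-y\|_\infty\ge2$ both $\lceil (x+y)/2\rceil$ and $\lfloor (x+y)/2\rfloor$ belong to $S$. Discrete midpoint convexity inequality for a pair $(x,y)$: $f(x)+f(y)\ge f(\lceil (x+y)/2\rceil)+f(\lfloor (x+y)/2\rfloor)$. $f$ is globally discrete midpoint convex if this inequality holds for all $x,y\in\mathbb{Z}^n$ with $\|x-y\|_\infty\ge2$. $f$ is locally discrete midpoint convex if $\operatorname{dom} f$ is a discrete midpoint convex set and the inequality holds for all $x,y\in\mathbb{Z}^n$ with $\|x-y\|_\infty=2$. *)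

theory Defs
  imports "HOL-Analysis.Analysis"
begin

text \<open>
  Points of the integer lattice are vectors of type \<open>int ^ 'n\<close>, with \<open>n = CARD('n)\<close>.  They are
  embedded into the Euclidean space \<open>real ^ 'n\<close> so that the library notions \<^const>\<open>midpoint\<close> and
  \<^const>\<open>infnorm\<close> (the maximum norm) apply to them.
\<close>

definition real_vec :: "int ^ 'n \<Rightarrow> real ^ 'n"
  where "real_vec x = (\<chi> i. real_of_int (x $ i))"

definition vec_ceiling :: "real ^ 'n \<Rightarrow> int ^ 'n"
  where "vec_ceiling x = (\<chi> i. \<lceil>x $ i\<rceil>)"

definition vec_floor :: "real ^ 'n \<Rightarrow> int ^ 'n"
  where "vec_floor x = (\<chi> i. \<lfloor>x $ i\<rfloor>)"

definition discrete_midpoint_convex_set :: "(int ^ 'n) set \<Rightarrow> bool"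
  where "discrete_midpoint_convex_set S \<longleftrightarrow>
    (\<forall>x\<in>S. \<forall>y\<in>S. infnorm (real_vec (x - y)) \<ge> 2 \<longrightarrow>
       vec_ceiling (midpoint (real_vec x) (real_vec y)) \<in> S \<and>
       vec_floor (midpoint (real_vec x) (real_vec y)) \<in> S)"

text \<open>
  Functions into the reals extended by \<open>+\<infinity>\<close> are modelled as \<^typ>\<open>ereal\<close>-valued functions.  The type
  also contains \<open>-\<infinity>\<close>; statements about such functions must exclude this value separately.
\<close>

definition effective_domain :: "(int ^ 'n \<Rightarrow> ereal) \<Rightarrow> (int ^ 'n) set"
  where "effective_domain f = {x. f x < \<infinity>}"

definition midpoint_inequality :: "(int ^ 'n \<Rightarrow> ereal) \<Rightarrow> int ^ 'n \<Rightarrow> int ^ 'n \<Rightarrow> bool"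
  where "midpoint_inequality f x y \<longleftrightarrow>
    f x + f y \<ge> f (vec_ceiling (midpoint (real_vec x) (real_vec y)))
              + f (vec_floor (midpoint (real_vec x) (real_vec y)))"

definition globally_discrete_midpoint_convex :: "(int ^ 'n \<Rightarrow> ereal) \<Rightarrow> bool"
  where "globally_discrete_midpoint_convex f \<longleftrightarrow>
    (\<forall>x y. infnorm (real_vec (x - y)) \<ge> 2 \<longrightarrow> midpoint_inequality f x y)"

definition locally_discrete_midpoint_convex :: "(int ^ 'n \<Rightarrow> ereal) \<Rightarrow> bool"
  where "locally_discrete_midpoint_convex f \<longleftrightarrow>
    discrete_midpoint_convex_set (effective_domain f) \<and>
    (\<forall>x y. infnorm (real_vec (x - y)) = 2 \<longrightarrow> midpoint_inequality f x y)"

end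

theory Submission
  imports Defs
begin

text \<open>
  The idea is a descent.  Let \<open>x\<close> be the given point, let \<open>y\<close> be any point of the effective domain,
  and let \<open>m\<close> be the maximum norm of \<open>z = y - x\<close>.  The vector \<open>z\<close> is a sum of \<open>m\<close> directions
  \<open>d\<^sub>1, \<dots>, d\<^sub>m\<close> with entries in \<open>{-1, 0, 1}\<close>, chosen such that their positive supports increase and
  their negative supports decrease with the index.  This skew order is dictated by the rounding: for
  \<open>k < l\<close>, the two rounded midpoints of \<open>w\<close> and \<open>w + d\<^sub>k + d\<^sub>l\<close> are \<open>w + d\<^sub>k\<close> (down) and
  \<open>w + d\<^sub>l\<close> (up).

  Two facts about the decomposition carry the proof.  The effective domain contains \<open>x + d\<^sub>k\<close> and
  \<open>y - d\<^sub>k\<close> for every \<open>k\<close> (\<open>plus_direction_mem\<close>, \<open>minus_direction_mem\<close>), and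
  \<open>f x + f y \<ge> f (x + d\<^sub>k) + f (y - d\<^sub>k)\<close> (\<open>parallelogram\<close>), which is obtained by adding up midpoint
  inequalities for pairs at distance two.  If a direction \<open>d\<close> occurs \<open>\<alpha>\<close> times, applying this to the
  pairs \<open>(x + s d, y)\<close> for \<open>s < \<alpha>\<close> and telescoping gives
  \<open>f x + \<alpha> f y \<ge> f (x + \<alpha> d) + \<alpha> f (y - d)\<close>, hence \<open>f (y - d) \<le> f y\<close> by the hypothesis on \<open>x\<close>.

  A direction that occurs \<open>\<alpha>\<close> times exists as soon as \<open>m > n (\<alpha> - 1)\<close>: along the sequence of
  directions each coordinate changes at most once, and a coordinate where \<open>z\<close> attains its norm never
  does, so that there are at most \<open>n\<close> different directions.  Since \<open>y - d\<close> has distance \<open>m - 1\<close> from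
  \<open>x\<close>, iterating leads into the box of radius \<open>n (\<alpha> - 1)\<close> around \<open>x\<close> without increasing \<open>f\<close>.  That box
  is finite, so a minimizer over it exists and is a global one.

  Global discrete midpoint convexity implies the local one, so that it suffices to treat the latter.
\<close>

section \<open>The skew decomposition of an integer vector\<close>

definition sup_norm_eq :: "int ^ 'n \<Rightarrow> int \<Rightarrow> bool"
  where "sup_norm_eq z m \<longleftrightarrow> (\<forall>i. \<bar>z $ i\<bar> \<le> m) \<and> (\<exists>i. \<bar>z $ i\<bar> = m)"

definition unit_step :: "int \<Rightarrow> int \<Rightarrow> int \<Rightarrow> int"
  where "unit_step m k t = (if t \<ge> m + 1 - k then 1 else if t \<le> - k then - 1 else 0)"

text \<open>
  For \<open>z\<close> of maximum norm \<open>m\<close>, the vectors \<open>direction m z k\<close> with \<open>1 \<le> k \<le> m\<close> sum up to \<open>z\<close>: a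
  coordinate \<open>p > 0\<close> is raised in the last \<open>p\<close> of the \<open>m\<close> steps, a coordinate \<open>- p < 0\<close> is lowered
  in the first \<open>p\<close> of them.
\<close>
definition direction :: "int \<Rightarrow> int ^ 'n \<Rightarrow> int \<Rightarrow> int ^ 'n"
  where "direction m z k = (\<chi> i. unit_step m k (z $ i))"

lemma direction_nth [simp]: "direction m z k $ i = unit_step m k (z $ i)"
  by (simp add: direction_def)

lemma sup_norm_eqE:
  assumes "sup_norm_eq z m"
  obtains i where "\<bar>z $ i\<bar> = m"
  using assms unfolding sup_norm_eq_def by blast

lemma sup_norm_eqD: "sup_norm_eq z m \<Longrightarrow> \<bar>z $ j\<bar> \<le> m"
  unfolding sup_norm_eq_def by blast

lemma sup_norm_eq_minus_commute: "sup_norm_eq (x - y) m \<longleftrightarrow> sup_norm_eq (y - x) m"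
  unfolding sup_norm_eq_def by (simp add: abs_minus_commute)

lemma ex_sup_norm_eq: "\<exists>m. sup_norm_eq z m"
proof -
  have "Max (range (\<lambda>i. \<bar>z $ i\<bar>)) \<in> range (\<lambda>i. \<bar>z $ i\<bar>)"
    by (rule Max_in) auto
  then obtain i where "\<bar>z $ i\<bar> = Max (range (\<lambda>i. \<bar>z $ i\<bar>))"
    by (metis imageE)
  moreover have "\<bar>z $ j\<bar> \<le> Max (range (\<lambda>i. \<bar>z $ i\<bar>))" for j
    by (rule Max_ge) auto
  ultimately show ?thesis
    unfolding sup_norm_eq_def by metis
qed

lemma sup_norm_eq_remove_direction:
  assumes "sup_norm_eq z m" "1 \<le> k" "k \<le> m"
  shows "sup_norm_eq (z - direction m z k) (m - 1)"
proof -
  obtain i where i: "\<bar>z $ i\<bar> = m"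
    using assms(1) by (rule sup_norm_eqE)
  note bound = sup_norm_eqD[OF assms(1)]
  have "\<bar>(z - direction m z k) $ i\<bar> = m - 1"
    using i assms(2,3) by (auto simp: unit_step_def)
  moreover have "\<bar>(z - direction m z k) $ j\<bar> \<le> m - 1" for j
    using bound[of j] assms(2,3) by (auto simp: unit_step_def)
  ultimately show ?thesis
    unfolding sup_norm_eq_def by blast
qed

text \<open>
  The decomposition is stable under removing one of its members, which is what makes inductions on
  the distance possible; the index \<open>if l < k then l else l + 1\<close> skips the removed member.
\<close>
lemma direction_remove_direction:
  assumes "sup_norm_eq z m" "1 \<le> k" "k \<le> m" "1 \<le> l" "l \<le> m - 1"
  shows "direction (m - 1) (z - direction m z k) l = direction m z (if l < k then l else l + 1)"
proof -
  have "\<bar>z $ i\<bar> \<le> m" for i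
    using assms(1) by (rule sup_norm_eqD)
  then show ?thesis
    using assms(2-) by (auto simp: vec_eq_iff unit_step_def)
qed

lemma direction_reflect:
  assumes "1 \<le> k" "k \<le> m"
  shows "direction m (x - y) (m + 1 - k) = - direction m (y - x) k"
  using assms by (auto simp: vec_eq_iff unit_step_def)

lemma direction_one:
  assumes "sup_norm_eq z 1"
  shows "direction 1 z 1 = z"
proof -
  have "\<bar>z $ i\<bar> \<le> 1" for i
    using assms by (rule sup_norm_eqD)
  then have "unit_step 1 1 (z $ i) = z $ i" for i
    unfolding unit_step_def by (smt (verit))
  then show ?thesis
    by (simp add: vec_eq_iff)
qed

lemma sup_norm_eq_two_directions:
  assumes "sup_norm_eq z m" "1 \<le> k" "k \<le> m" "1 \<le> l" "l \<le> m"
  shows "sup_norm_eq (direction m z k + direction m z l) 2"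
proof -
  obtain i where i: "\<bar>z $ i\<bar> = m"
    using assms(1) by (rule sup_norm_eqE)
  have "\<bar>(direction m z k + direction m z l) $ i\<bar> = 2"
    using i assms(2-) by (auto simp: unit_step_def)
  moreover have "\<bar>(direction m z k + direction m z l) $ j\<bar> \<le> 2" for j
    by (simp add: unit_step_def)
  ultimately show ?thesis
    unfolding sup_norm_eq_def by blast
qed

section \<open>Repeated directions\<close>

text \<open>
  In each coordinate the sequence of directions is monotone and takes values in \<open>{0, 1}\<close> or in
  \<open>{- 1, 0}\<close>, so it has at most one jump.
\<close>
lemma unit_step_single_jump:
  assumes "unit_step m k t \<noteq> unit_step m l t" "unit_step m k' t \<noteq> unit_step m l' t"
    and "1 \<le> k" "k \<le> l" "l \<le> k'" "k' \<le> l'" "l' \<le> m"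
  shows False
  using assms by (auto simp: unit_step_def split: if_splits)

lemma direction_constant_between:
  assumes "direction m z k = direction m z l" "1 \<le> k" "k \<le> j" "j \<le> l" "l \<le> m"
  shows "direction m z j = direction m z k"
  using assms unit_step_single_jump[of m k _ j j l]
  by (simp add: vec_eq_iff) metis

text \<open>
  The directions are compared at the \<open>n + 1\<close> indices \<open>1, \<alpha>, 2 \<alpha> - 1, \<dots>\<close>.  If each of the \<open>n\<close> gaps
  contained a jump, different gaps would have jumps in different coordinates, none of which is a
  coordinate of maximal absolute value; but only \<open>n - 1\<close> such coordinates are available.
\<close>
lemma ex_repeated_direction:
  fixes z :: "int ^ 'n"
  assumes z: "sup_norm_eq z m" and "\<alpha> > 0" and m: "int CARD('n) * (\<alpha> - 1) < m"
  shows "\<exists>a d. 0 \<le> a \<and> a + \<alpha> \<le> m \<and> (\<forall>l. a < l \<and> l \<le> a + \<alpha> \<longrightarrow> direction m z l = d)"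
proof -
  define t where "t j = int j * (\<alpha> - 1) + 1" for j
  have t_mono: "t j \<le> t j'" if "j \<le> j'" for j j'
    using that \<open>\<alpha> > 0\<close> by (simp add: t_def mult_right_mono)
  have t_ge: "1 \<le> t j" for j
    using \<open>\<alpha> > 0\<close> by (simp add: t_def)
  have t_le: "t j \<le> m" if "j \<le> CARD('n)" for j
    using t_mono[OF that] m by (simp add: t_def)
  have t_Suc: "t (Suc j) = t j + \<alpha> - 1" for j
    by (simp add: t_def algebra_simps)
  have "\<exists>j<CARD('n). direction m z (t j) = direction m z (t (Suc j))"
  proof (rule ccontr)
    assume "\<not> ?thesis"
    then have "\<forall>j<CARD('n). \<exists>i. unit_step m (t j) (z $ i) \<noteq> unit_step m (t (Suc j)) (z $ i)"
      by (auto simp: vec_eq_iff)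
    then obtain i where i:
      "unit_step m (t j) (z $ i j) \<noteq> unit_step m (t (Suc j)) (z $ i j)" if "j < CARD('n)" for j
      by metis
    obtain i\<^sub>0 where i0: "\<bar>z $ i\<^sub>0\<bar> = m"
      using z by (rule sup_norm_eqE)
    have "inj_on i {..<CARD('n)}"
    proof (rule linorder_inj_onI)
      fix j j' assume j: "j < j'" "j \<in> {..<CARD('n)}" "j' \<in> {..<CARD('n)}"
      show "i j \<noteq> i j'"
      proof
        assume "i j = i j'"
        then show False
          using unit_step_single_jump[of m "t j" "z $ i j" "t (Suc j)" "t j'" "t (Suc j')"]
            i[of j] i[of j'] j t_mono[of j "Suc j"] t_mono[of "Suc j" j'] t_mono[of j' "Suc j'"]
            t_ge t_le[of "Suc j'"]
          by auto
      qed
    qed auto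
    moreover have "i ` {..<CARD('n)} \<subseteq> UNIV - {i\<^sub>0}"
    proof clarsimp
      fix j assume "j < CARD('n)" "i\<^sub>0 = i j"
      then show False
        using i[of j] i0 t_ge[of j] t_ge[of "Suc j"] t_le[of j] t_le[of "Suc j"]
        by (auto simp: unit_step_def abs_if split: if_splits)
    qed
    ultimately have "card {..<CARD('n)} \<le> card (UNIV - {i\<^sub>0})"
      by (rule card_inj_on_le) simp
    moreover have "card (UNIV - {i\<^sub>0}) = CARD('n) - 1"
      by (simp add: card_Diff_singleton)
    moreover have "0 < CARD('n)"
      by (rule zero_less_card_finite)
    ultimately show False
      unfolding card_lessThan by linarith
  qed
  then obtain j where j: "j < CARD('n)" "direction m z (t j) = direction m z (t (Suc j))"
    by blast
  have "direction m z l = direction m z (t j)" if "t j - 1 < l \<and> l \<le> t j - 1 + \<alpha>" for l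
    using direction_constant_between[OF j(2) t_ge[of j], of l] t_le[of "Suc j"] t_Suc[of j] j(1) that
    by simp
  moreover have "0 \<le> t j - 1" "t j - 1 + \<alpha> \<le> m"
    using t_ge[of j] t_le[of "Suc j"] t_Suc[of j] j(1) by simp_all
  ultimately show ?thesis
    by blast
qed

section \<open>The parallelogram inequality\<close>

definition mid_down :: "int ^ 'n \<Rightarrow> int ^ 'n \<Rightarrow> int ^ 'n"
  where "mid_down x y = (\<chi> i. (x $ i + y $ i) div 2)"

definition mid_up :: "int ^ 'n \<Rightarrow> int ^ 'n \<Rightarrow> int ^ 'n"
  where "mid_up x y = (\<chi> i. (x $ i + y $ i + 1) div 2)"

lemma mid_down_nth [simp]: "mid_down x y $ i = (x $ i + y $ i) div 2"
  by (simp add: mid_down_def)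

lemma mid_up_nth [simp]: "mid_up x y $ i = (x $ i + y $ i + 1) div 2"
  by (simp add: mid_up_def)

lemma
  assumes "1 \<le> k" "k < l" "l \<le> m"
  shows mid_down_directions:
      "mid_down w (w + direction m z k + direction m z l) = w + direction m z k"
    and mid_up_directions:
      "mid_up w (w + direction m z k + direction m z l) = w + direction m z l"
  using assms by (auto simp: vec_eq_iff unit_step_def)

text \<open>
  A locally discrete midpoint convex function, given by its effective domain \<open>S\<close> and its real values
  \<open>g\<close> there, with midpoints and norms expressed in integer arithmetic.
\<close>
locale midpoint_convex =
  fixes S :: "(int ^ 'n) set" and g :: "int ^ 'n \<Rightarrow> real"
  assumes mid_mem: "\<lbrakk>x \<in> S; y \<in> S; sup_norm_eq (y - x) m; m \<ge> 2\<rbrakk>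
      \<Longrightarrow> mid_down x y \<in> S \<and> mid_up x y \<in> S"
    and mid_le: "\<lbrakk>x \<in> S; y \<in> S; sup_norm_eq (y - x) 2\<rbrakk>
      \<Longrightarrow> g (mid_up x y) + g (mid_down x y) \<le> g x + g y"
begin

lemma square_mem:
  assumes "w \<in> S" "w + direction m z k + direction m z l \<in> S"
    and "sup_norm_eq z m" "1 \<le> k" "k < l" "l \<le> m"
  shows "w + direction m z k \<in> S" "w + direction m z l \<in> S"
  using mid_mem[OF assms(1,2), of 2] sup_norm_eq_two_directions[OF assms(3), of k l] assms(4-)
    mid_down_directions[OF assms(4-6), of w z] mid_up_directions[OF assms(4-6), of w z]
  by (simp_all add: add.assoc)

lemma square_le:
  assumes "w \<in> S" "w + direction m z k + direction m z l \<in> S"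
    and "sup_norm_eq z m" "1 \<le> k" "k < l" "l \<le> m"
  shows "g (w + direction m z k) + g (w + direction m z l)
    \<le> g w + g (w + direction m z k + direction m z l)"
  using mid_le[OF assms(1,2)] sup_norm_eq_two_directions[OF assms(3), of k l] assms(4-)
    mid_down_directions[OF assms(4-6), of w z] mid_up_directions[OF assms(4-6), of w z]
  by (simp add: add.assoc add.commute)

text \<open>
  It suffices to reach \<open>x + d\<^sub>1\<close>: the induction hypothesis for the pair \<open>(x + d\<^sub>1, y)\<close> then yields
  \<open>x + d\<^sub>1 + d\<^sub>k\<close>, and rounding the midpoint of that point and \<open>x\<close> gives \<open>x + d\<^sub>k\<close>.  To reach
  \<open>x + d\<^sub>1\<close>, the induction hypothesis is applied to \<open>x\<close> and a rounded midpoint of \<open>x\<close> and \<open>y\<close>.  The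
  midpoint rounded down has \<open>d\<^sub>1\<close> as its first direction, except when \<open>m\<close> is odd and \<open>z\<close> has an entry
  equal to \<open>m\<close>; this case takes a detour through \<open>x + d\<^sub>1 + d\<^sub>2\<close>.
\<close>
lemma plus_direction_mem:
  assumes "x \<in> S" "y \<in> S" "sup_norm_eq (y - x) m" "1 \<le> k" "k \<le> m"
  shows "x + direction m (y - x) k \<in> S"
  using assms
proof (induction "nat m" arbitrary: x y m k rule: less_induct)
  case less
  note x = \<open>x \<in> S\<close> and y = \<open>y \<in> S\<close> and norm = \<open>sup_norm_eq (y - x) m\<close>
  have IH: "v + direction p (w - v) l \<in> S"
    if "p < m" "v \<in> S" "w \<in> S" "sup_norm_eq (w - v) p" "1 \<le> l" "l \<le> p" for v w p l
    using less.hyps[of p v w l] that by auto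
  define z where "z = y - x"
  have norm_z: "sup_norm_eq z m"
    using norm by (simp add: z_def)
  obtain i where i: "\<bar>z $ i\<bar> = m"
    using norm_z by (rule sup_norm_eqE)
  note bound = sup_norm_eqD[OF norm_z]
  have y_nth: "y $ j = x $ j + z $ j" for j
    by (simp add: z_def)
  show ?case
  proof (cases "m = 1")
    case True
    then show ?thesis
      using less.prems direction_one[of "y - x"] by auto
  next
    case False
    then have m: "m \<ge> 2"
      using less.prems by linarith
    define r where "r = (m + 1) div 2"
    have r: "1 \<le> r" "r < m"
      using m unfolding r_def by auto
    have mids: "mid_down x y \<in> S" "mid_up x y \<in> S"
      using mid_mem[OF x y norm m] by auto
    have first: "x + direction m z 1 \<in> S"
    proof (cases "even m \<or> (\<forall>j. z $ j \<noteq> m)")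
      case True
      have down: "(mid_down x y - x) $ j = z $ j div 2" for j
        by (simp add: y_nth)
      have "\<bar>(mid_down x y - x) $ i\<bar> = r"
        using True i unfolding down r_def by (auto simp: abs_if elim!: evenE split: if_splits)
      moreover have "\<bar>(mid_down x y - x) $ j\<bar> \<le> r" for j
        using bound[of j] unfolding down r_def by linarith
      ultimately have "sup_norm_eq (mid_down x y - x) r"
        unfolding sup_norm_eq_def by blast
      then have "x + direction r (mid_down x y - x) 1 \<in> S"
        using IH[OF r(2) x mids(1)] r(1) by simp
      moreover have "unit_step r 1 (z $ j div 2) = unit_step m 1 (z $ j)" for j
      proof -
        have "r \<le> z $ j div 2 \<longleftrightarrow> m \<le> z $ j"
          using True bound[of j] unfolding r_def
          by (smt (verit) even_two_times_div_two odd_two_times_div_two_succ)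
        moreover have "z $ j div 2 \<le> - 1 \<longleftrightarrow> z $ j \<le> - 1"
          by linarith
        ultimately show ?thesis
          by (simp add: unit_step_def)
      qed
      then have "direction r (mid_down x y - x) 1 = direction m z 1"
        by (simp add: vec_eq_iff y_nth)
      ultimately show ?thesis
        by simp
    next
      case False
      then obtain i' where i': "z $ i' = m" and odd: "odd m"
        by auto
      have mr: "m = 2 * r - 1"
        using odd unfolding r_def by (auto elim!: oddE)
      have up: "(mid_up x y - x) $ j = (z $ j + 1) div 2" for j
        by (simp add: y_nth)
      define e where "e = direction r (mid_up x y - x) 1"
      have e_nth: "e $ j = (if z $ j \<ge> m then 1 else if z $ j \<le> - 2 then - 1 else 0)" for j
      proof -
        have "r \<le> (z $ j + 1) div 2 \<longleftrightarrow> m \<le> z $ j"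
          unfolding mr by linarith
        moreover have "(z $ j + 1) div 2 \<le> - 1 \<longleftrightarrow> z $ j \<le> - 2"
          by linarith
        ultimately show ?thesis
          unfolding e_def direction_nth up by (simp add: unit_step_def)
      qed
      have "\<bar>(mid_up x y - x) $ i'\<bar> = r"
        unfolding up i' using r(1) by (simp add: mr)
      moreover have "\<bar>(mid_up x y - x) $ j\<bar> \<le> r" for j
        using bound[of j] unfolding up mr by linarith
      ultimately have "sup_norm_eq (mid_up x y - x) r"
        unfolding sup_norm_eq_def by blast
      then have e_mem: "x + e \<in> S"
        using IH[OF r(2) x mids(2)] r(1) unfolding e_def by simp
      have diff: "(y - (x + e)) $ j = z $ j - e $ j" for j
        by (simp add: y_nth)
      have m3: "m \<ge> 3"
        using m mr by presburger
      have "\<bar>(y - (x + e)) $ i'\<bar> = m - 1"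
        unfolding diff e_nth i' using m by simp
      moreover have "\<bar>(y - (x + e)) $ j\<bar> \<le> m - 1" for j
        using bound[of j] m3 unfolding diff e_nth by auto
      ultimately have "sup_norm_eq (y - (x + e)) (m - 1)"
        unfolding sup_norm_eq_def by blast
      then have "x + e + direction (m - 1) (y - (x + e)) 1 \<in> S"
        using IH[of "m - 1" "x + e" y 1] e_mem y m3 by simp
      \<comment> \<open>The first direction raises the positive support of \<open>d\<^sub>1\<close> and lowers the negative
        support of \<open>d\<^sub>2\<close>; the second raises that of \<open>d\<^sub>2\<close> and lowers that of \<open>d\<^sub>1\<close>.\<close>
      moreover have "e $ j + unit_step (m - 1) 1 (z $ j - e $ j)
          = unit_step m 1 (z $ j) + unit_step m 2 (z $ j)" for j
        using bound[of j] m3 unfolding e_nth unit_step_def by auto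
      then have "e + direction (m - 1) (y - (x + e)) 1 = direction m z 1 + direction m z 2"
        unfolding vec_eq_iff vector_add_component direction_nth diff by blast
      ultimately have "x + direction m z 1 + direction m z 2 \<in> S"
        by (simp add: add.assoc)
      then show ?thesis
        using square_mem(1)[of x m z 1 2] x norm_z m by simp
    qed
    show ?thesis
    proof (cases "k = 1")
      case True
      then show ?thesis
        using first by (simp add: z_def)
    next
      case False
      then have k: "1 < k" "k \<le> m"
        using less.prems by auto
      have diff: "y - (x + direction m z 1) = z - direction m z 1"
        by (simp add: z_def)
      have "sup_norm_eq (z - direction m z 1) (m - 1)"
        using sup_norm_eq_remove_direction[OF norm_z] m by simp
      then have "x + direction m z 1 + direction (m - 1) (z - direction m z 1) (k - 1) \<in> S"
        using IH[of "m - 1" "x + direction m z 1" y "k - 1"] first y k unfolding diff by simp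
      moreover have "direction (m - 1) (z - direction m z 1) (k - 1) = direction m z k"
        using direction_remove_direction[OF norm_z, of 1 "k - 1"] k by simp
      ultimately show ?thesis
        using square_mem(2)[of x m z 1 k] x norm_z k by (simp add: z_def)
    qed
  qed
qed

lemma minus_direction_mem:
  assumes "x \<in> S" "y \<in> S" "sup_norm_eq (y - x) m" "1 \<le> k" "k \<le> m"
  shows "y - direction m (y - x) k \<in> S"
  using plus_direction_mem[of y x m "m + 1 - k"] assms
  by (simp add: sup_norm_eq_minus_commute[of x y] direction_reflect)

text \<open>
  Removing another direction \<open>d\<^sub>l\<close> at the end \<open>y\<close> shortens the pair.  The inequality for
  \<open>(x, y - d\<^sub>l)\<close> and the one for the square spanned by \<open>d\<^sub>k\<close> and \<open>d\<^sub>l\<close> below \<open>y\<close> add up to the one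
  for \<open>(x, y)\<close>.
\<close>
lemma parallelogram:
  assumes "x \<in> S" "y \<in> S" "sup_norm_eq (y - x) m" "1 \<le> k" "k \<le> m"
  shows "g (x + direction m (y - x) k) + g (y - direction m (y - x) k) \<le> g x + g y"
  using assms
proof (induction "nat m" arbitrary: y m k rule: less_induct)
  case less
  define z where "z = y - x"
  have norm_z: "sup_norm_eq z m"
    using less.prems by (simp add: z_def)
  show ?case
  proof (cases "m = 1")
    case True
    then have "direction m (y - x) k = y - x"
      using less.prems direction_one[of "y - x"] by auto
    then show ?thesis
      by simp
  next
    case False
    define l :: int where "l = (if k = 1 then 2 else 1)"
    define k' where "k' = (if k = 1 then 1 else k - 1)"
    have l: "1 \<le> l" "l \<le> m" and k': "1 \<le> k'" "k' \<le> m - 1" "(if k' < l then k' else k' + 1) = k"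
      using False less.prems unfolding l_def k'_def by auto
    define u where "u = y - direction m z l"
    have u: "u \<in> S"
      using minus_direction_mem[OF less.prems(1-3) l] by (simp add: u_def z_def)
    have u_diff: "u - x = z - direction m z l"
      by (simp add: u_def z_def)
    have norm_u: "sup_norm_eq (u - x) (m - 1)"
      unfolding u_diff using sup_norm_eq_remove_direction[OF norm_z l] .
    have dir: "direction (m - 1) (u - x) k' = direction m z k"
      unfolding u_diff using direction_remove_direction[OF norm_z l k'(1,2)] k'(3) by simp
    have "g (x + direction m z k) + g (u - direction m z k) \<le> g x + g u"
      using less.hyps[of "m - 1" u k'] less.prems(1) u norm_u k'(1,2) unfolding dir by simp
    moreover define w where "w = u - direction m z k"
    have w: "w \<in> S"
      using minus_direction_mem[OF less.prems(1) u norm_u k'(1,2)] unfolding dir w_def .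
    have corners: "w + direction m z k = u" "w + direction m z l = y - direction m z k"
      "w + direction m z k + direction m z l = y" "w + direction m z l + direction m z k = y"
      by (simp_all add: w_def u_def)
    have "g u + g (y - direction m z k) \<le> g w + g y"
    proof (cases "k = 1")
      case True
      then have "k < l"
        by (simp add: l_def)
      then show ?thesis
        using square_le[of w m z k l] w less.prems norm_z l corners by simp
    next
      case False
      then have "l < k"
        using less.prems by (simp add: l_def)
      then show ?thesis
        using square_le[of w m z l k] w less.prems norm_z l unfolding corners by simp
    qed
    ultimately show ?thesis
      by (simp add: w_def z_def)
  qed
qed

section \<open>Descent towards a scaled local minimum\<close>

text \<open>
  Only the point \<open>x\<close> moves: with \<open>y\<close> kept fixed, \<open>d\<close> stays available for all \<open>s\<close> steps, whereas
  moving both ends would use up its occurrences twice as fast.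
\<close>
lemma repeated_direction_telescope:
  assumes "x \<in> S" "y \<in> S" "sup_norm_eq (y - x) m" "0 \<le> a" "a + int s \<le> m"
    and "\<And>l. a < l \<Longrightarrow> l \<le> a + int s \<Longrightarrow> direction m (y - x) l = d"
  shows "x + int s *s d \<in> S \<and> g (x + int s *s d) + real s * g (y - d) \<le> g x + real s * g y"
  using assms
proof (induction s arbitrary: x m)
  case 0
  then show ?case
    by simp
next
  case (Suc s)
  define k where "k = a + int (Suc s)"
  have k: "1 \<le> k" "k \<le> m"
    using Suc.prems by (auto simp: k_def)
  have d: "direction m (y - x) k = d"
    using Suc.prems(6)[of k] by (simp add: k_def)
  have x': "x + d \<in> S"
    using plus_direction_mem[OF Suc.prems(1-3) k] by (simp add: d)
  have diff: "y - (x + d) = (y - x) - direction m (y - x) k"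
    by (simp add: d)
  have "sup_norm_eq (y - (x + d)) (m - 1)"
    unfolding diff using sup_norm_eq_remove_direction[OF Suc.prems(3) k] .
  moreover have "direction (m - 1) (y - (x + d)) l = d" if "a < l" "l \<le> a + int s" for l
    unfolding diff using direction_remove_direction[OF Suc.prems(3) k, of l] that
      Suc.prems(4,5) Suc.prems(6)[of l] by (simp add: k_def)
  ultimately have IH: "x + d + int s *s d \<in> S"
    "g (x + d + int s *s d) + real s * g (y - d) \<le> g (x + d) + real s * g y"
    using Suc.IH[OF x' Suc.prems(2), of "m - 1"] Suc.prems(4,5) by auto
  have "x + d + int s *s d = x + int (Suc s) *s d"
    by (simp add: vec_eq_iff algebra_simps)
  moreover have "g (x + d) + g (y - d) \<le> g x + g y"
    using parallelogram[OF Suc.prems(1-3) k] by (simp add: d)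
  ultimately show ?case
    using IH by (simp add: algebra_simps)
qed

lemma descent_step:
  assumes "x \<in> S" "y \<in> S" "sup_norm_eq (y - x) m" "\<alpha> > 0" "int CARD('n) * (\<alpha> - 1) < m"
    and min: "\<And>d :: int ^ 'n. \<lbrakk>\<forall>i. d $ i \<in> {-1, 0, 1}; x + \<alpha> *s d \<in> S\<rbrakk> \<Longrightarrow> g x \<le> g (x + \<alpha> *s d)"
  shows "\<exists>y'\<in>S. sup_norm_eq (y' - x) (m - 1) \<and> g y' \<le> g y"
proof -
  obtain a d where a: "0 \<le> a" "a + \<alpha> \<le> m"
    and d: "\<And>l. a < l \<Longrightarrow> l \<le> a + \<alpha> \<Longrightarrow> direction m (y - x) l = d"
    using ex_repeated_direction[OF assms(3-5)] by blast
  have first: "direction m (y - x) (a + 1) = d"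
    using d[of "a + 1"] \<open>\<alpha> > 0\<close> by simp
  have "x + \<alpha> *s d \<in> S"
    and le: "g (x + \<alpha> *s d) + of_int \<alpha> * g (y - d) \<le> g x + of_int \<alpha> * g y"
    using repeated_direction_telescope[OF assms(1-3) a(1), of "nat \<alpha>" d] a(2) d \<open>\<alpha> > 0\<close> by auto
  moreover have "\<forall>i. d $ i \<in> {-1, 0, 1}"
    unfolding first[symmetric] by (simp add: unit_step_def)
  ultimately have "g x \<le> g (x + \<alpha> *s d)"
    using min by blast
  with le have "of_int \<alpha> * g (y - d) \<le> of_int \<alpha> * g y"
    by linarith
  then have "g (y - d) \<le> g y"
    using \<open>\<alpha> > 0\<close> by simp
  moreover have "y - d \<in> S"
    using minus_direction_mem[OF assms(1-3), of "a + 1"] a \<open>\<alpha> > 0\<close> by (simp add: first)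
  moreover have "sup_norm_eq (y - d - x) (m - 1)"
    using sup_norm_eq_remove_direction[OF assms(3), of "a + 1"] a \<open>\<alpha> > 0\<close>
    unfolding first cancel_ab_semigroup_add_class.diff_right_commute[of y d x] by simp
  ultimately show ?thesis
    by blast
qed

lemma descent_into_box:
  assumes "x \<in> S" "y \<in> S" "\<alpha> > 0"
    and "\<And>d :: int ^ 'n. \<lbrakk>\<forall>i. d $ i \<in> {-1, 0, 1}; x + \<alpha> *s d \<in> S\<rbrakk> \<Longrightarrow> g x \<le> g (x + \<alpha> *s d)"
  shows "\<exists>y'\<in>S. (\<forall>i. \<bar>(y' - x) $ i\<bar> \<le> int CARD('n) * (\<alpha> - 1)) \<and> g y' \<le> g y"
proof -
  obtain m where "sup_norm_eq (y - x) m"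
    using ex_sup_norm_eq by blast
  then show ?thesis
    using \<open>y \<in> S\<close>
  proof (induction "nat m" arbitrary: y m rule: less_induct)
    case less
    show ?case
    proof (cases "int CARD('n) * (\<alpha> - 1) < m")
      case True
      then obtain y' where y': "y' \<in> S" "sup_norm_eq (y' - x) (m - 1)" "g y' \<le> g y"
        using descent_step[OF assms(1) less.prems(2,1) assms(3) _ assms(4)] by blast
      have "0 \<le> int CARD('n) * (\<alpha> - 1)"
        using \<open>\<alpha> > 0\<close> by simp
      then have "nat (m - 1) < nat m"
        using True by linarith
      from less.hyps[OF this y'(2,1)] y'(3) show ?thesis
        by (meson order_trans)
    next
      case False
      have "\<bar>(y - x) $ i\<bar> \<le> m" for i
        using less.prems(1) by (rule sup_norm_eqD)
      then have "\<bar>(y - x) $ i\<bar> \<le> int CARD('n) * (\<alpha> - 1)" for i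
        using False by (meson linorder_not_le order_trans)
      then show ?thesis
        using less.prems(2) by blast
    qed
  qed
qed

end

section \<open>Extended real-valued midpoint convex functions\<close>

lemma vec_floor_midpoint: "vec_floor (midpoint (real_vec x) (real_vec y)) = mid_down x y"
  using floor_divide_of_int_eq[where ?'a = real, of "x $ i + y $ i" 2 for i]
  by (simp add: vec_eq_iff vec_floor_def midpoint_def real_vec_def)

lemma vec_ceiling_midpoint: "vec_ceiling (midpoint (real_vec x) (real_vec y)) = mid_up x y"
proof -
  have "\<lceil>(of_int a + of_int b) / (2::real)\<rceil> = (a + b + 1) div 2" for a b :: int
    using ceiling_divide_eq_div[of "a + b" 2, where ?'a = real] by simp
  then show ?thesis
    by (simp add: vec_eq_iff vec_ceiling_def midpoint_def real_vec_def)
qed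

lemma infnorm_real_vec_le_iff:
  fixes z :: "int ^ 'n"
  shows "infnorm (real_vec z) \<le> c \<longleftrightarrow> (\<forall>i. real_of_int \<bar>z $ i\<bar> \<le> c)"
proof -
  have "infnorm (real_vec z) = Max (range (\<lambda>i. \<bar>real_vec z $ i\<bar>))"
    unfolding infnorm_cart by (subst cSup_eq_Max) (auto simp: full_SetCompr_eq)
  then show ?thesis
    by (simp add: real_vec_def)
qed

lemma infnorm_real_vec:
  assumes "sup_norm_eq z m"
  shows "infnorm (real_vec z) = real_of_int m"
proof (rule antisym)
  obtain i where i: "\<bar>z $ i\<bar> = m"
    using assms by (rule sup_norm_eqE)
  note bound = sup_norm_eqD[OF assms]
  show "infnorm (real_vec z) \<le> real_of_int m"
    using bound unfolding infnorm_real_vec_le_iff of_int_le_iff by blast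
  show "real_of_int m \<le> infnorm (real_vec z)"
    using infnorm_real_vec_le_iff[of z "infnorm (real_vec z)"] i by auto
qed

lemma infnorm_real_vec_diff:
  assumes "sup_norm_eq (y - x) m"
  shows "infnorm (real_vec (x - y)) = real_of_int m"
  using assms by (intro infnorm_real_vec) (simp add: sup_norm_eq_minus_commute)

lemma globally_imp_locally_discrete_midpoint_convex:
  assumes "globally_discrete_midpoint_convex f" "\<And>x. f x \<noteq> -\<infinity>"
  shows "locally_discrete_midpoint_convex f"
proof -
  have "a < \<infinity> \<and> b < \<infinity>" if "a + b \<le> c + e" "c < \<infinity>" "e < \<infinity>" "a \<noteq> -\<infinity>" "b \<noteq> -\<infinity>"
    for a b c e :: ereal
    using that by (cases a; cases b; cases c; cases e) auto
  then have "discrete_midpoint_convex_set (effective_domain f)"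
    using assms
    unfolding discrete_midpoint_convex_set_def globally_discrete_midpoint_convex_def
      midpoint_inequality_def effective_domain_def
    by (smt (verit) mem_Collect_eq)
  then show ?thesis
    using assms(1)
    unfolding locally_discrete_midpoint_convex_def globally_discrete_midpoint_convex_def by simp
qed

lemma midpoint_convex_effective_domain:
  fixes f :: "int ^ 'n \<Rightarrow> ereal"
  assumes "locally_discrete_midpoint_convex f" and not_minf: "\<And>x. f x \<noteq> -\<infinity>"
  shows "midpoint_convex (effective_domain f) (\<lambda>x. real_of_ereal (f x))"
proof
  fix x y :: "int ^ 'n" and m :: int
  assume xy: "x \<in> effective_domain f" "y \<in> effective_domain f"
  have mem: "mid_down x y \<in> effective_domain f \<and> mid_up x y \<in> effective_domain f"
    if "sup_norm_eq (y - x) m" "m \<ge> 2" for m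
    using assms(1) xy infnorm_real_vec_diff[OF that(1)] that(2)
    unfolding locally_discrete_midpoint_convex_def discrete_midpoint_convex_set_def
    by (simp add: vec_floor_midpoint vec_ceiling_midpoint)
  show "mid_down x y \<in> effective_domain f \<and> mid_up x y \<in> effective_domain f"
    if "sup_norm_eq (y - x) m" "m \<ge> 2"
    using mem that .
  show "real_of_ereal (f (mid_up x y)) + real_of_ereal (f (mid_down x y))
      \<le> real_of_ereal (f x) + real_of_ereal (f y)" if "sup_norm_eq (y - x) 2"
  proof -
    have "f (mid_up x y) + f (mid_down x y) \<le> f x + f y"
      using assms(1) infnorm_real_vec_diff[OF that]
      unfolding locally_discrete_midpoint_convex_def midpoint_inequality_def
      by (simp add: vec_floor_midpoint vec_ceiling_midpoint)
    moreover have "f w = ereal (real_of_ereal (f w))" if "w \<in> effective_domain f" for w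
      using that not_minf[of w] unfolding effective_domain_def by (cases "f w") auto
    ultimately show ?thesis
      using xy mem[OF that] by (metis ereal_less_eq(3) order_refl plus_ereal.simps(1))
  qed
qed

lemma finite_int_box:
  fixes x :: "int ^ 'n"
  shows "finite {y. \<forall>i. \<bar>(x - y) $ i\<bar> \<le> c}"
proof (rule finite_subset)
  show "{y. \<forall>i. \<bar>(x - y) $ i\<bar> \<le> c} \<subseteq> vec_lambda ` (\<Pi>\<^sub>E i\<in>UNIV. {x $ i - c..x $ i + c})"
  proof
    fix y assume "y \<in> {y. \<forall>i. \<bar>(x - y) $ i\<bar> \<le> c}"
    then have "x $ i - c \<le> y $ i \<and> y $ i \<le> x $ i + c" for i
      by (auto simp: abs_le_iff algebra_simps dest!: spec[of _ i])
    then show "y \<in> vec_lambda ` (\<Pi>\<^sub>E i\<in>UNIV. {x $ i - c..x $ i + c})"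
      by (intro image_eqI[of _ _ "vec_nth y"]) auto
  qed
qed (intro finite_imageI finite_PiE; simp)

theorem theorem5p1:
  fixes f :: "int ^ 'n \<Rightarrow> ereal" and \<alpha> :: int and x\<^sub>\<alpha> :: "int ^ 'n"
  assumes "\<And>x. f x \<noteq> -\<infinity>"
    and "locally_discrete_midpoint_convex f \<or> globally_discrete_midpoint_convex f"
    and "\<alpha> > 0"
    and "x\<^sub>\<alpha> \<in> effective_domain f"
    and "\<And>d :: int ^ 'n. (\<forall>i. d $ i \<in> {-1, 0, 1}) \<Longrightarrow> f x\<^sub>\<alpha> \<le> f (x\<^sub>\<alpha> + \<alpha> *s d)"
  shows "\<exists>x :: int ^ 'n. (\<forall>y. f x \<le> f y) \<and>
    infnorm (real_vec (x\<^sub>\<alpha> - x)) \<le> real CARD('n) * (real_of_int \<alpha> - 1)"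
proof -
  define S where "S = effective_domain f"
  define g where "g x = real_of_ereal (f x)" for x
  define c where "c = int CARD('n) * (\<alpha> - 1)"
  define B where "B = {y. \<forall>i. \<bar>(x\<^sub>\<alpha> - y) $ i\<bar> \<le> c}"
  have f_eq: "f x = ereal (g x)" if "x \<in> S" for x
    using that assms(1)[of x] unfolding S_def g_def effective_domain_def by (cases "f x") auto
  have "locally_discrete_midpoint_convex f"
    using assms(1,2) globally_imp_locally_discrete_midpoint_convex by blast
  then interpret midpoint_convex S g
    unfolding S_def g_def using assms(1) by (rule midpoint_convex_effective_domain)
  have x_mem: "x\<^sub>\<alpha> \<in> S" "x\<^sub>\<alpha> \<in> B"
    using assms(3,4) by (simp_all add: S_def B_def c_def)
  have min: "g x\<^sub>\<alpha> \<le> g (x\<^sub>\<alpha> + \<alpha> *s d)"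
    if "\<forall>i. d $ i \<in> {-1, 0, 1}" "x\<^sub>\<alpha> + \<alpha> *s d \<in> S" for d :: "int ^ 'n"
    using assms(5)[OF that(1)] f_eq[OF x_mem(1)] f_eq[OF that(2)] by simp
  have reach: "\<exists>y'\<in>B. f y' \<le> f y" for y
  proof (cases "y \<in> S")
    case True
    then obtain y' where y': "y' \<in> S" "\<forall>i. \<bar>(y' - x\<^sub>\<alpha>) $ i\<bar> \<le> c" "g y' \<le> g y"
      using descent_into_box[OF x_mem(1) True assms(3) min] unfolding c_def by blast
    then have "y' \<in> B"
      by (simp add: B_def abs_minus_commute)
    then show ?thesis
      using y' True f_eq by (intro bexI[of _ y']) auto
  next
    case False
    then show ?thesis
      using x_mem(2) by (intro bexI[of _ "x\<^sub>\<alpha>"]) (auto simp: S_def effective_domain_def)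
  qed
  have "finite B"
    unfolding B_def by (rule finite_int_box)
  then obtain x where x: "x \<in> B" "\<And>y. y \<in> B \<Longrightarrow> f x \<le> f y"
    using ex_is_arg_min_if_finite[of B f] x_mem(2) by (auto simp: is_arg_min_linorder)
  have "f x \<le> f y" for y
    using reach[of y] x(2) order_trans by blast
  moreover have "infnorm (real_vec (x\<^sub>\<alpha> - x)) \<le> real CARD('n) * (real_of_int \<alpha> - 1)"
  proof -
    have "real_of_int \<bar>(x\<^sub>\<alpha> - x) $ i\<bar> \<le> real_of_int c" for i
      using x(1) unfolding B_def of_int_le_iff by blast
    then show ?thesis
      unfolding infnorm_real_vec_le_iff by (simp add: c_def)
  qed
  ultimately show ?thesis
    by blast
qed

end
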